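(* Let $X$ be a synchronized system, let $Y$ be a shift space, and let $\phi:X\to Y$ be a semi-open code which is onto. Then $Y$ is synchronized.
   Context: Shift spaces are closed shift-invariant subsets of full shifts over finite alphabets; $\mathcal B(X)$ is the language of $X$. A code between shift spaces is a sliding block code (equivalently, a continuous shift-commuting map). $X$ is irreducible if for all $u,v\in\mathcal B(X)$ there is $w$ with $uwv\in\mathcal B(X)$. A word $v\in\mathcal B(X)$ is synchronizing if whenever $uv,vw\in\mathcal B(X)$ we have $uvw\in\mathcal B(X)$; an irreducible shift space with a synchronizing word is called a synchronized system (is synchronized). A map is semi-open if the image of every non-empty open set has non-empty interior. *)

theory Defs
  imports "HOL-Analysis.Analysis"
begin

text \<open>Points are two-sided sequences; the alphabet is a finite set of letters, given explicitly
  so that it may be any finite subset of the letter type.\<close>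

definition full_shift :: "'a set \<Rightarrow> (int \<Rightarrow> 'a) topology" where
  "full_shift A = product_topology (\<lambda>_. discrete_topology A) UNIV"

definition shift_map :: "(int \<Rightarrow> 'a) \<Rightarrow> int \<Rightarrow> 'a" where
  "shift_map x = (\<lambda>i. x (i + 1))"

definition shift_space :: "'a set \<Rightarrow> (int \<Rightarrow> 'a) set \<Rightarrow> bool" where
  "shift_space A X \<longleftrightarrow>
     finite A \<and> closedin (full_shift A) X \<and> shift_map ` X = X"

definition shift_topology :: "'a set \<Rightarrow> (int \<Rightarrow> 'a) set \<Rightarrow> (int \<Rightarrow> 'a) topology" where
  "shift_topology A X = subtopology (full_shift A) X"

text \<open>The interval \<open>[i..j]\<close> is empty for \<open>j < i\<close>, so the language of a
  nonempty shift space contains the empty word.\<close>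

definition language :: "(int \<Rightarrow> 'a) set \<Rightarrow> 'a list set" where
  "language X = {map x [i..j] | x i j. x \<in> X}"

definition irreducible_shift :: "(int \<Rightarrow> 'a) set \<Rightarrow> bool" where
  "irreducible_shift X \<longleftrightarrow>
     (\<forall>u\<in>language X. \<forall>v\<in>language X. \<exists>w. u @ w @ v \<in> language X)"

definition synchronizing_word :: "(int \<Rightarrow> 'a) set \<Rightarrow> 'a list \<Rightarrow> bool" where
  "synchronizing_word X v \<longleftrightarrow> v \<in> language X \<and>
     (\<forall>u w. u @ v \<in> language X \<longrightarrow> v @ w \<in> language X \<longrightarrow> u @ v @ w \<in> language X)"

definition synchronized_system :: "'a set \<Rightarrow> (int \<Rightarrow> 'a) set \<Rightarrow> bool" where
  "synchronized_system A X \<longleftrightarrow>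
     shift_space A X \<and> irreducible_shift X \<and> (\<exists>v. synchronizing_word X v)"

text \<open>Sliding block codes: memory \<open>m\<close>, anticipation \<open>n\<close> and block map \<open>F\<close>, of which only
  the values on words of \<open>X\<close> of length \<open>m + n + 1\<close> matter.\<close>

definition sliding_block_code ::
  "(int \<Rightarrow> 'a) set \<Rightarrow> (int \<Rightarrow> 'b) set \<Rightarrow> ((int \<Rightarrow> 'a) \<Rightarrow> int \<Rightarrow> 'b) \<Rightarrow> bool" where
  "sliding_block_code X Y \<phi> \<longleftrightarrow> \<phi> \<in> X \<rightarrow> Y \<and>
     (\<exists>(m::int) (n::int) (F :: 'a list \<Rightarrow> 'b). - m \<le> n \<and>
        (\<forall>x\<in>X. \<forall>i. \<phi> x i = F (map x [i - m..i + n])))"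

definition semi_open_map :: "'a topology \<Rightarrow> 'b topology \<Rightarrow> ('a \<Rightarrow> 'b) \<Rightarrow> bool" where
  "semi_open_map S T f \<longleftrightarrow>
     (\<forall>U. openin S U \<and> U \<noteq> {} \<longrightarrow> T interior_of (f ` U) \<noteq> {})"

end

theory Submission
  imports Defs
begin

text \<open>Irreducibility passes to every factor: surround preimages of two words of \<open>Y\<close> by the
  window of the code, connect them in \<open>X\<close>, and apply \<open>\<phi>\<close> (\<open>irreducible_shift_image\<close>).

  For the synchronizing word, let \<open>v\<close> be synchronizing for \<open>X\<close> and occur at \<open>0\<close> in \<open>x0 \<in> X\<close>,
  and let \<open>U\<close> be the set of points of \<open>X\<close> that agree with \<open>x0\<close> on a window around \<open>0\<close> which contains this
  occurrence of \<open>v\<close> and is at least as wide as the window of the code. By semi-openness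
  \<open>\<phi> ` U\<close> contains all points of \<open>Y\<close> that agree with some \<open>y0\<close> on \<open>[-k..k]\<close>. Then \<open>w = y0[-k..k]\<close> is
  synchronizing: if \<open>uw\<close> and \<open>wz\<close> occur in points \<open>y1\<close> and \<open>y2\<close> of \<open>Y\<close>, both with \<open>w\<close> at \<open>-k\<close>,
  these have preimages \<open>x1\<close> and \<open>x2\<close> in \<open>U\<close>. As both contain \<open>v\<close> at \<open>0\<close>, a long stretch of \<open>x1\<close>
  to the left can be glued to a long stretch of \<open>x2\<close> to the right
  (\<open>synchronizing_word_glue\<close>). The image of the resulting point follows \<open>y1\<close> up to
  coordinate \<open>0\<close> and \<open>y2\<close> from there on, and since \<open>y1\<close> and \<open>y2\<close> agree on \<open>[-k..k]\<close>, it
  contains \<open>uwz\<close>.\<close>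


section \<open>Occurrences of words in points\<close>

text \<open>The word \<open>u\<close> appears in the point \<open>x\<close> with its first letter at coordinate \<open>p\<close>.\<close>

definition occurs :: "(int \<Rightarrow> 'a) \<Rightarrow> int \<Rightarrow> 'a list \<Rightarrow> bool" where
  "occurs x p u \<longleftrightarrow> (\<forall>i<length u. x (p + int i) = u ! i)"

lemma occurs_Cons: "occurs x p (a # u) \<longleftrightarrow> x p = a \<and> occurs x (p + 1) u"
  by (simp add: occurs_def All_less_Suc2 add.assoc)

lemma occurs_append:
  "occurs x p (u @ v) \<longleftrightarrow> occurs x p u \<and> occurs x (p + int (length u)) v"
proof (induction u arbitrary: p)
  case Nil
  then show ?case by (simp add: occurs_def)
next
  case (Cons a u)
  then show ?case by (simp add: occurs_Cons add.assoc)
qed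

lemma occurs_block: "occurs x a (map x [a..b])"
  by (auto simp: occurs_def)

lemma occurs_block_iff:
  "occurs x a (map y [a..b]) \<longleftrightarrow> (\<forall>i\<in>{a..b}. x i = y i)"
proof
  assume *: "occurs x a (map y [a..b])"
  show "\<forall>i\<in>{a..b}. x i = y i"
  proof
    fix i assume "i \<in> {a..b}"
    then show "x i = y i"
      using *[unfolded occurs_def, rule_format, of "nat (i - a)"] by auto
  qed
qed (auto simp: occurs_def)

lemma occurs_cong:
  assumes "occurs x p u" "\<And>i. p \<le> i \<Longrightarrow> i < p + int (length u) \<Longrightarrow> y i = x i"
  shows "occurs y p u"
  using assms by (auto simp: occurs_def)

lemma occurs_between:
  assumes "occurs x p u" "occurs x q v" "p + int (length u) \<le> q"
  shows "\<exists>w. occurs x p (u @ w @ v)"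
proof
  show "occurs x p (u @ map x [p + int (length u)..q - 1] @ v)"
    using assms by (auto simp: occurs_append occurs_block)
qed

lemma occurs_imp_language: "x \<in> X \<Longrightarrow> occurs x p u \<Longrightarrow> u \<in> language X"
proof -
  assume "x \<in> X" "occurs x p u"
  then have "u = map x [p..p + int (length u) - 1]"
    by (intro nth_equalityI) (auto simp: occurs_def)
  with \<open>x \<in> X\<close> show ?thesis unfolding language_def by blast
qed

lemma shift_invariant:
  assumes "shift_map ` X = X" "x \<in> X"
  shows "(\<lambda>i. x (i + k)) \<in> X"
proof (induction k rule: int_induct[where k = 0])
  case base
  then show ?case using assms by simp
next
  case (step1 k)
  then have "shift_map (\<lambda>i. x (i + k)) \<in> X" using assms(1) by blast
  then show ?case by (simp add: shift_map_def add_ac)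
next
  case (step2 k)
  then obtain z where z: "z \<in> X" "(\<lambda>i. x (i + k)) = shift_map z" using assms(1) by blast
  have "z i = x (i + (k - 1))" for i
    using fun_cong[OF z(2), of "i - 1"] by (simp add: shift_map_def algebra_simps)
  then have "z = (\<lambda>i. x (i + (k - 1)))" by blast
  with z(1) show ?case by simp
qed

text \<open>By shift invariance a word of the language can be placed at any prescribed coordinate.\<close>

lemma language_occurs_at:
  assumes "shift_map ` X = X" "u \<in> language X"
  obtains x where "x \<in> X" "occurs x p u"
proof -
  obtain x i j where x: "x \<in> X" "u = map x [i..j]"
    using assms(2) unfolding language_def by blast
  show ?thesis
  proof
    show "(\<lambda>l. x (l + (i - p))) \<in> X" using shift_invariant[OF assms(1) x(1)] .
    show "occurs (\<lambda>l. x (l + (i - p))) p u" by (auto simp: x(2) occurs_def add.commute)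
  qed
qed

text \<open>Two points with a synchronizing word at the same place can be joined there, along finite
  stretches of any length \<open>N\<close> on either side.\<close>

lemma synchronizing_word_glue:
  fixes N :: int
  assumes inv: "shift_map ` X = X" and v: "synchronizing_word X v"
    and x1: "x1 \<in> X" "occurs x1 p v" and x2: "x2 \<in> X" "occurs x2 p v" and "N \<ge> 0"
  obtains x where "x \<in> X"
    "\<And>i. p - N \<le> i \<Longrightarrow> i < p + int (length v) \<Longrightarrow> x i = x1 i"
    "\<And>i. p \<le> i \<Longrightarrow> i < p + int (length v) + N \<Longrightarrow> x i = x2 i"
proof -
  define q where "q = p + int (length v)"
  define a where "a = map x1 [p - N..p - 1]"
  define b where "b = map x2 [q..q + N - 1]"
  have len: "int (length a) = N" using \<open>N \<ge> 0\<close> by (simp add: a_def)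
  have "occurs x1 (p - N) (a @ v)"
    using x1 len by (simp add: occurs_append a_def occurs_block)
  moreover have "occurs x2 p (v @ b)"
    using x2 by (simp add: occurs_append b_def occurs_block q_def)
  ultimately have "a @ v @ b \<in> language X"
    using v x1(1) x2(1) occurs_imp_language unfolding synchronizing_word_def by blast
  then obtain x where x: "x \<in> X" "occurs x (p - N) (a @ v @ b)"
    using language_occurs_at[OF inv] by blast
  then have xa: "occurs x (p - N) a" and xv: "occurs x p v" and xb: "occurs x q b"
    using len by (auto simp: occurs_append q_def)
  have "x i = x1 i" if "p - N \<le> i" "i < p" for i
    using xa that by (auto simp: a_def occurs_block_iff)
  moreover have "x i = x2 i" if "q \<le> i" "i < q + N" for i
    using xb that by (auto simp: b_def occurs_block_iff)
  moreover have "x i = x1 i" "x i = x2 i" if "p \<le> i" "i < q" for i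
  proof -
    have i: "nat (i - p) < length v" "p + int (nat (i - p)) = i" using that by (auto simp: q_def)
    show "x i = x1 i" "x i = x2 i"
      using xv[unfolded occurs_def, rule_format, OF i(1)]
        x1(2)[unfolded occurs_def, rule_format, OF i(1)]
        x2(2)[unfolded occurs_def, rule_format, OF i(1)] by (simp_all only: i(2))
  qed
  ultimately show ?thesis
    using that[OF x(1)] unfolding q_def by (meson not_le)
qed


section \<open>Cylinder sets\<close>

lemma openin_shift_topology_cylinder:
  assumes "X \<subseteq> topspace (full_shift A)" "finite I"
  shows "openin (shift_topology A X) {x \<in> X. \<forall>i\<in>I. x i = c i}"
proof -
  have "openin (full_shift A) (PiE UNIV (\<lambda>i. if i \<in> I then {c i} \<inter> A else A))"
    unfolding full_shift_def
  proof (rule product_topology_basis)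
    show "openin (discrete_topology A) (if i \<in> I then {c i} \<inter> A else A)" for i
      by simp
    show "finite {i. (if i \<in> I then {c i} \<inter> A else A) \<noteq> topspace (discrete_topology A)}"
      by (rule finite_subset[OF _ assms(2)]) auto
  qed
  moreover have "{x \<in> X. \<forall>i\<in>I. x i = c i} = PiE UNIV (\<lambda>i. if i \<in> I then {c i} \<inter> A else A) \<inter> X"
  proof -
    have "x i \<in> A" if "x \<in> X" for x i
      using that assms(1) by (auto simp: full_shift_def)
    then show ?thesis by (auto simp: PiE_UNIV_domain Pi_iff split: if_splits)
  qed
  ultimately show ?thesis
    unfolding shift_topology_def openin_subtopology by blast
qed

text \<open>The central cylinders form a neighbourhood basis.\<close>

lemma openin_shift_topology_contains_cylinder:
  assumes "Y \<subseteq> topspace (full_shift B)" "openin (shift_topology B Y) T" "y0 \<in> T"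
  obtains k :: int where "k \<ge> 0" "{y \<in> Y. \<forall>i\<in>{-k..k}. y i = y0 i} \<subseteq> T"
proof -
  obtain W where W: "openin (full_shift B) W" "T = W \<inter> Y"
    using assms(2) unfolding shift_topology_def openin_subtopology by blast
  with assms(3) obtain V where V: "finite {i. V i \<noteq> B}"
    "y0 \<in> PiE UNIV V" "PiE UNIV V \<subseteq> W"
    unfolding full_shift_def openin_product_topology_alt by auto
  define k where "k = Max (insert 0 (abs ` {i. V i \<noteq> B}))"
  have k: "\<bar>i\<bar> \<le> k" if "V i \<noteq> B" for i
    unfolding k_def using V(1) that by (intro Max_ge) auto
  have "k \<ge> 0" unfolding k_def using V(1) by (intro Max_ge) auto
  moreover have "y \<in> T" if y: "y \<in> Y" "\<forall>i\<in>{-k..k}. y i = y0 i" for y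
  proof -
    have "y i \<in> V i" for i
    proof (cases "V i = B")
      case True
      then show ?thesis using y(1) assms(1) by (auto simp: full_shift_def)
    next
      case False
      then have "i \<in> {-k..k}" using k[of i] by auto
      then have "y i = y0 i" using y(2) by blast
      then show ?thesis using V(2) by auto
    qed
    then show ?thesis using V(3) W(2) y(1) by (auto simp: PiE_UNIV_domain)
  qed
  ultimately show ?thesis using that by blast
qed


section \<open>Images under sliding block codes\<close>

text \<open>The letter of \<open>\<phi> x\<close> at a coordinate depends only on the letters of \<open>x\<close> at distance at most
  \<open>r\<close>. The two coordinates \<open>i\<close> and \<open>i'\<close> are independent, so this includes commutation with the
  shift.\<close>

definition code_radius ::
  "(int \<Rightarrow> 'a) set \<Rightarrow> ((int \<Rightarrow> 'a) \<Rightarrow> int \<Rightarrow> 'b) \<Rightarrow> int \<Rightarrow> bool" where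
  "code_radius X \<phi> r \<longleftrightarrow> r \<ge> 0 \<and>
     (\<forall>x\<in>X. \<forall>x'\<in>X. \<forall>i i'. (\<forall>j\<in>{-r..r}. x (i + j) = x' (i' + j)) \<longrightarrow> \<phi> x i = \<phi> x' i')"

lemma code_radiusD:
  assumes "code_radius X \<phi> r" "x \<in> X" "x' \<in> X"
    "\<And>j. -r \<le> j \<Longrightarrow> j \<le> r \<Longrightarrow> x (i + j) = x' (i' + j)"
  shows "\<phi> x i = \<phi> x' i'"
  using assms unfolding code_radius_def by (metis atLeastAtMost_iff)

lemma sliding_block_code_radius:
  assumes "sliding_block_code X Y \<phi>"
  obtains r where "code_radius X \<phi> r"
proof -
  obtain m n F where F: "\<And>x i. x \<in> X \<Longrightarrow> \<phi> x i = F (map x [i - m..i + n])"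
    using assms unfolding sliding_block_code_def by blast
  \<comment> \<open>The absolute values are needed since \<open>m\<close> or \<open>n\<close> may be negative.\<close>
  define r where "r = max \<bar>m\<bar> \<bar>n\<bar>"
  have "\<phi> x i = \<phi> x' i'"
    if x: "x \<in> X" "x' \<in> X" and eq: "\<forall>j\<in>{-r..r}. x (i + j) = x' (i' + j)" for x x' i i'
  proof -
    have "map x [i - m..i + n] = map x' [i' - m..i' + n]"
    proof (rule nth_equalityI)
      fix l assume "l < length (map x [i - m..i + n])"
      then have l: "int l < m + n + 1" by auto
      then have "int l - m \<in> {-r..r}" by (auto simp: r_def)
      with eq have "x (i + (int l - m)) = x' (i' + (int l - m))" by blast
      with l show "map x [i - m..i + n] ! l = map x' [i' - m..i' + n] ! l"
        by (simp add: algebra_simps)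
    qed simp
    then show ?thesis by (simp only: F x)
  qed
  then have "code_radius X \<phi> r"
    unfolding code_radius_def by (auto simp: r_def)
  with that show ?thesis .
qed

text \<open>A word of the image is enforced by a preimage word with margins of width \<open>r\<close>.\<close>

lemma language_image_preimage_word:
  assumes "code_radius X \<phi> r" "u \<in> language (\<phi> ` X)"
  obtains a where "a \<in> language X" "int (length a) = int (length u) + 2 * r"
    "\<And>s p. s \<in> X \<Longrightarrow> occurs s p a \<Longrightarrow> occurs (\<phi> s) (p + r) u"
proof -
  obtain x i j where x: "x \<in> X" and u: "u = map (\<phi> x) [i..j]"
    using assms(2) unfolding language_def by blast
  have r: "r \<ge> 0" using assms(1) by (simp add: code_radius_def)
  define a where "a = map x [i - r..i + int (length u) - 1 + r]"
  show ?thesis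
  proof
    show "a \<in> language X"
      unfolding a_def by (rule occurs_imp_language[OF x occurs_block])
    show "int (length a) = int (length u) + 2 * r"
      using r by (simp add: a_def)
    fix s p assume s: "s \<in> X" "occurs s p a"
    show "occurs (\<phi> s) (p + r) u"
      unfolding occurs_def
    proof (intro allI impI)
      fix l assume l: "l < length u"
      have "\<phi> s (p + r + int l) = \<phi> x (i + int l)"
      proof (rule code_radiusD[OF assms(1) s(1) x])
        fix t assume t: "- r \<le> t" "t \<le> r"
        then show "s (p + r + int l + t) = x (i + int l + t)"
          using s(2)[unfolded occurs_def, rule_format, of "nat (r + int l + t)"] l
          by (auto simp: a_def algebra_simps)
      qed
      then show "\<phi> s (p + r + int l) = u ! l" using l by (simp add: u)
    qed
  qed
qed

lemma irreducible_shift_image: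
  assumes X: "shift_map ` X = X" "irreducible_shift X" and r: "code_radius X \<phi> r"
  shows "irreducible_shift (\<phi> ` X)"
  unfolding irreducible_shift_def
proof (intro ballI)
  fix u v assume u: "u \<in> language (\<phi> ` X)" and v: "v \<in> language (\<phi> ` X)"
  obtain a where a: "a \<in> language X" "int (length a) = int (length u) + 2 * r"
    "\<And>s p. s \<in> X \<Longrightarrow> occurs s p a \<Longrightarrow> occurs (\<phi> s) (p + r) u"
    using language_image_preimage_word[OF r u] by blast
  obtain b where b: "b \<in> language X"
    "\<And>s p. s \<in> X \<Longrightarrow> occurs s p b \<Longrightarrow> occurs (\<phi> s) (p + r) v"
    using language_image_preimage_word[OF r v] by metis
  obtain w where "a @ w @ b \<in> language X"
    using X(2) a(1) b(1) unfolding irreducible_shift_def by blast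
  then obtain s where s: "s \<in> X" "occurs s 0 (a @ w @ b)"
    using language_occurs_at[OF X(1)] by blast
  define q where "q = int (length a) + int (length w)"
  have "occurs (\<phi> s) (0 + r) u" "occurs (\<phi> s) (q + r) v"
    using s a(3)[of s 0] b(2)[of s q] by (simp_all add: occurs_append q_def)
  moreover have "0 + r + int (length u) \<le> q + r"
    using a(2) r by (simp add: q_def code_radius_def)
  ultimately obtain w' where "occurs (\<phi> s) (0 + r) (u @ w' @ v)"
    using occurs_between by blast
  then show "\<exists>w. u @ w @ v \<in> language (\<phi> ` X)"
    using s(1) occurs_imp_language by blast
qed

text \<open>If every point of \<open>Y\<close> that agrees with \<open>y0\<close> on \<open>[-k..k]\<close> has a preimage that agrees with
  \<open>x0\<close> on \<open>[-K..K]\<close>, where \<open>x0\<close> contains the synchronizing word \<open>v\<close> at \<open>0\<close>, then the central block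
  of \<open>y0\<close> is synchronizing. The choice of \<open>K\<close> makes \<open>[-K..K]\<close> cover both this occurrence of \<open>v\<close> and
  the code window around \<open>0\<close>.\<close>

lemma synchronizing_word_image:
  assumes X: "shift_map ` X = X" "synchronizing_word X v"
    and Y: "shift_map ` Y = Y" "\<phi> ` X = Y"
    and radius: "code_radius X \<phi> r"
    and x0: "occurs x0 0 v" and K: "K = r + int (length v)"
    and k: "k \<ge> 0" "{y \<in> Y. \<forall>i\<in>{-k..k}. y i = y0 i} \<subseteq> \<phi> ` {x \<in> X. \<forall>i\<in>{-K..K}. x i = x0 i}"
    and y0: "y0 \<in> Y"
  shows "synchronizing_word Y (map y0 [-k..k])"
  unfolding synchronizing_word_def
proof (intro conjI allI impI)
  show "map y0 [-k..k] \<in> language Y"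
    by (rule occurs_imp_language[OF y0 occurs_block])
next
  have r: "r \<ge> 0" using radius by (simp add: code_radius_def)
  fix u z assume uw: "u @ map y0 [-k..k] \<in> language Y" and wz: "map y0 [-k..k] @ z \<in> language Y"
  define p where "p = - k - int (length u)"
  have len: "int (length (map y0 [-k..k])) = 2 * k + 1" using k(1) by simp
  obtain y1 where y1: "y1 \<in> Y" "occurs y1 p (u @ map y0 [-k..k])"
    using language_occurs_at[OF Y(1) uw] by blast
  obtain y2 where y2: "y2 \<in> Y" "occurs y2 (- k) (map y0 [-k..k] @ z)"
    using language_occurs_at[OF Y(1) wz] by blast
  have y1_u: "occurs y1 p u" and y1_w: "\<And>i. -k \<le> i \<Longrightarrow> i \<le> k \<Longrightarrow> y1 i = y0 i"
    using y1(2) by (auto simp: occurs_append occurs_block_iff p_def)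
  have y2_z: "occurs y2 (k + 1) z" and y2_w: "\<And>i. -k \<le> i \<Longrightarrow> i \<le> k \<Longrightarrow> y2 i = y0 i"
    using y2(2) len by (auto simp: occurs_append occurs_block_iff algebra_simps)
  have preimage: "\<exists>x. x \<in> X \<and> \<phi> x = y \<and> (\<forall>i\<in>{-K..K}. x i = x0 i)"
    if "y \<in> Y" "\<And>i. -k \<le> i \<Longrightarrow> i \<le> k \<Longrightarrow> y i = y0 i" for y
  proof -
    have "y \<in> {y \<in> Y. \<forall>i\<in>{-k..k}. y i = y0 i}" using that by simp
    then have "y \<in> \<phi> ` {x \<in> X. \<forall>i\<in>{-K..K}. x i = x0 i}" by (rule subsetD[OF k(2)])
    then show ?thesis by blast
  qed
  obtain x1 where x1: "x1 \<in> X" "\<phi> x1 = y1" "\<And>i. -K \<le> i \<Longrightarrow> i \<le> K \<Longrightarrow> x1 i = x0 i"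
    using preimage[OF y1(1) y1_w] by auto
  obtain x2 where x2: "x2 \<in> X" "\<phi> x2 = y2" "\<And>i. -K \<le> i \<Longrightarrow> i \<le> K \<Longrightarrow> x2 i = x0 i"
    using preimage[OF y2(1) y2_w] by auto
  have v1: "occurs x1 0 v" and v2: "occurs x2 0 v"
    using r by (auto intro!: occurs_cong[OF x0] x1(3) x2(3) simp: K)
  define N where "N = k + r + int (length u) + int (length z) + 1"
  have "N \<ge> 0" using k(1) r by (simp add: N_def)
  then obtain x where x: "x \<in> X"
    "\<And>i. - N \<le> i \<Longrightarrow> i < int (length v) \<Longrightarrow> x i = x1 i"
    "\<And>i. 0 \<le> i \<Longrightarrow> i < int (length v) + N \<Longrightarrow> x i = x2 i"
    using synchronizing_word_glue[OF X x1(1) v1 x2(1) v2] by (metis add_0 diff_0)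
  \<comment> \<open>The glued point follows \<open>x1\<close> up to the end of \<open>v\<close> and \<open>x2\<close> from \<open>0\<close> on. As \<open>x1\<close> and \<open>x2\<close>
    agree on \<open>[-K..K]\<close>, it follows both throughout the code window around \<open>0\<close>.\<close>
  have left: "x i = x1 i" if "- N \<le> i" "i \<le> r" for i
  proof (cases "i < 0")
    case False
    with that show ?thesis
      using x(3)[of i] x1(3)[of i] x2(3)[of i] r k(1) by (simp add: K N_def)
  qed (use that x(2) in auto)
  have right: "x i = x2 i" if "- r \<le> i" "i < N" for i
  proof (cases "i < 0")
    case True
    with that show ?thesis
      using x(2)[of i] x1(3)[of i] x2(3)[of i] r k(1) by (simp add: K N_def)
  qed (use that x(3) in auto)
  have img_left: "\<phi> x i = y1 i" if "p \<le> i" "i \<le> 0" for i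
    unfolding x1(2)[symmetric] using that
    by (intro code_radiusD[OF radius x(1) x1(1)] left) (auto simp: N_def p_def)
  have img_right: "\<phi> x i = y2 i" if "0 \<le> i" "i < k + 1 + int (length z)" for i
    unfolding x2(2)[symmetric] using that
    by (intro code_radiusD[OF radius x(1) x2(1)] right) (auto simp: N_def)
  have "occurs (\<phi> x) p u"
    using k(1) by (intro occurs_cong[OF y1_u] img_left) (auto simp: p_def)
  moreover have "occurs (\<phi> x) (- k) (map y0 [-k..k])"
    unfolding occurs_block_iff
  proof
    fix i assume "i \<in> {-k..k}"
    then show "\<phi> x i = y0 i"
      using img_left[of i] img_right[of i] y1_w[of i] y2_w[of i]
      by (cases "i \<le> 0") (auto simp: p_def)
  qed
  moreover have "occurs (\<phi> x) (k + 1) z"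
    using k(1) by (intro occurs_cong[OF y2_z] img_right) auto
  ultimately have "occurs (\<phi> x) p (u @ map y0 [-k..k] @ z)"
    using len by (simp add: occurs_append p_def algebra_simps)
  then show "u @ map y0 [-k..k] @ z \<in> language Y"
    using x(1) Y(2) occurs_imp_language by blast
qed


section \<open>Semi-open factors of synchronized systems\<close>

theorem theorem4p3:
  fixes A :: "'a set" and B :: "'b set"
    and X :: "(int \<Rightarrow> 'a) set" and Y :: "(int \<Rightarrow> 'b) set"
    and \<phi> :: "(int \<Rightarrow> 'a) \<Rightarrow> int \<Rightarrow> 'b"
  assumes "synchronized_system A X"
    and "shift_space B Y"
    and "sliding_block_code X Y \<phi>"
    and "semi_open_map (shift_topology A X) (shift_topology B Y) \<phi>"
    and "\<phi> ` X = Y"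
  shows "synchronized_system B Y"
proof -
  obtain v where X: "shift_space A X" "irreducible_shift X" and v: "synchronizing_word X v"
    using assms(1) unfolding synchronized_system_def by blast
  have Xinv: "shift_map ` X = X" and Xtop: "X \<subseteq> topspace (full_shift A)"
    using X(1) closedin_subset unfolding shift_space_def by auto
  have Yinv: "shift_map ` Y = Y" and Ytop: "Y \<subseteq> topspace (full_shift B)"
    using assms(2) closedin_subset unfolding shift_space_def by auto
  obtain r where r: "code_radius X \<phi> r"
    using sliding_block_code_radius[OF assms(3)] by blast
  have "v \<in> language X" using v by (simp add: synchronizing_word_def)
  then obtain x0 where x0: "x0 \<in> X" "occurs x0 0 v"
    using language_occurs_at[OF Xinv] by blast
  define K where "K = r + int (length v)"
  define U where "U = {x \<in> X. \<forall>i\<in>{-K..K}. x i = x0 i}"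
  have "openin (shift_topology A X) U"
    unfolding U_def by (rule openin_shift_topology_cylinder[OF Xtop]) simp
  moreover have "x0 \<in> U" using x0(1) by (simp add: U_def)
  ultimately have "shift_topology B Y interior_of (\<phi> ` U) \<noteq> {}"
    using assms(4) unfolding semi_open_map_def by blast
  then obtain y0 where y0: "y0 \<in> shift_topology B Y interior_of (\<phi> ` U)" by blast
  obtain k :: int where k: "k \<ge> 0"
    "{y \<in> Y. \<forall>i\<in>{-k..k}. y i = y0 i} \<subseteq> shift_topology B Y interior_of (\<phi> ` U)"
    using openin_shift_topology_contains_cylinder[OF Ytop openin_interior_of y0] by blast
  have sub: "{y \<in> Y. \<forall>i\<in>{-k..k}. y i = y0 i} \<subseteq> \<phi> ` U"
    by (rule order_trans[OF k(2) interior_of_subset])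
  have "y0 \<in> Y"
    using y0 interior_of_subset[of "shift_topology B Y" "\<phi> ` U"] assms(5) by (auto simp: U_def)
  have "synchronizing_word Y (map y0 [-k..k])"
    by (rule synchronizing_word_image[OF Xinv v Yinv assms(5) r x0(2) K_def k(1)
          sub[unfolded U_def] \<open>y0 \<in> Y\<close>])
  moreover have "irreducible_shift Y"
    using irreducible_shift_image[OF Xinv X(2) r] assms(5) by simp
  ultimately show ?thesis
    using assms(2) unfolding synchronized_system_def by blast
qed

end
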